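(* Let $0\le\alpha,\beta\le\gamma<1$ with $\alpha+\beta>1$. Let $X_j^n$ be the forest-fire random field with parameters $\alpha,\beta,\gamma$, and let $Y_n=\sum_{j=0}^n X_j^n$ for $n\ge0$. Then $$\lim_{n\to\infty}\mathbb{P}\{Y_n=0\}\ \ge\ \frac{(1-\alpha)(1-\beta)}{\alpha\beta},$$ and for every $\varepsilon>0$ there is an $n_0=n_0(\varepsilon)$ such that $$\mathbb{E}[Y_n]\ \le\ \left(\frac{\alpha+\beta-1}{\alpha\beta}+\varepsilon\right)n\qquad\text{for all } n\ge n_0.$$
   Context: Forest-fire random field with parameters $\alpha,\beta,\gamma$, where $0\le\alpha,\beta\le\gamma\le1$: $\mathbb{N}=\{0,1,2,\ldots\}$. A family of $\{0,1\}$-valued random variables $X(j,k)$, $j,k\in\mathbb{N}$, is given on a probability space; write $X_j^n=X(j,n-j)$ for $0\le j\le n$. Boundary conditions: $X(0,0)=1$ and $X(j,-1)=X(-1,k)=0$ for all $j,k\in\mathbb{N}$, i.e. $X_0^0=1$ and $X_{-1}^n=X_{n+1}^n=0$ for all $n\ge0$. Let $\mathcal{F}_n=\sigma(X_j^m:\ 0\le j\le m\le n)$. The law of the field is defined inductively: for every $n\ge0$, given $\mathcal{F}_n$, the variables $X_0^{n+1},\ldots,X_{n+1}^{n+1}$ are conditionally independent, and for each $0\le j\le n+1$ the conditional law of $X_j^{n+1}$ given $\mathcal{F}_n$ depends only on $(X_{j-1}^n,X_j^n)$: the conditional probability that $X_j^{n+1}=1$ equals $0$ if $(X_{j-1}^n,X_j^n)=(0,0)$,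 equals $\alpha$ if it is $(1,0)$, equals $\beta$ if it is $(0,1)$, and equals $\gamma$ if it is $(1,1)$. Up to null sets $\{Y_n=0\}\subset\{Y_{n+1}=0\}$, so $\mathbb{P}\{Y_n=0\}$ is nondecreasing in $n$ and its limit exists. *)

theory Defs
  imports "HOL-Probability.Probability"
begin

definition cond_prob_alg :: "'a measure \<Rightarrow> 'a measure \<Rightarrow> 'a set \<Rightarrow> 'a \<Rightarrow> real" where
  "cond_prob_alg M F E = real_cond_exp M F (indicator E)"

text \<open>Conditional independence given the sub-\<open>\<sigma>\<close>-algebra \<open>F\<close> of the random variables \<open>X i\<close>,
  \<open>i \<in> I\<close>, with values in \<open>N i\<close>; the shape follows \<^const>\<open>prob_space.indep_vars\<close>.\<close>

definition cond_indep_vars ::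
    "'a measure \<Rightarrow> 'a measure \<Rightarrow> ('i \<Rightarrow> 'b measure) \<Rightarrow> ('i \<Rightarrow> 'a \<Rightarrow> 'b) \<Rightarrow> 'i set \<Rightarrow> bool" where
  "cond_indep_vars M F N X I \<longleftrightarrow>
     (\<forall>i\<in>I. X i \<in> measurable M (N i)) \<and>
     (\<forall>J A. J \<subseteq> I \<longrightarrow> J \<noteq> {} \<longrightarrow> finite J \<longrightarrow> (\<forall>i\<in>J. A i \<in> sets (N i)) \<longrightarrow>
        (AE \<omega> in M. cond_prob_alg M F (\<Inter>i\<in>J. X i -` A i \<inter> space M) \<omega>
                   = (\<Prod>i\<in>J. cond_prob_alg M F (X i -` A i \<inter> space M) \<omega>)))"

text \<open>\<open>diag_site X n j\<close> is \<open>X\<^sub>j\<^sup>n = X(j, n - j)\<close>. The index \<open>j\<close> is an integer so that the boundary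
  values \<open>X(-1, n + 1) = X(n + 1, -1) = 0\<close> are included.\<close>

definition diag_site :: "(nat \<Rightarrow> nat \<Rightarrow> 'a \<Rightarrow> real) \<Rightarrow> nat \<Rightarrow> int \<Rightarrow> 'a \<Rightarrow> real" where
  "diag_site X n j \<omega> = (if 0 \<le> j \<and> j \<le> int n then X (nat j) (n - nat j) \<omega> else 0)"

definition past_alg :: "'a measure \<Rightarrow> (nat \<Rightarrow> nat \<Rightarrow> 'a \<Rightarrow> real) \<Rightarrow> nat \<Rightarrow> 'a measure" where
  "past_alg M X n = sigma (space M)
     {diag_site X m (int j) -` A \<inter> space M | j m A. j \<le> m \<and> m \<le> n \<and> A \<in> sets borel}"

text \<open>Only arguments in \<open>{0, 1}\<close> matter.\<close>

definition fire_rate :: "real \<Rightarrow> real \<Rightarrow> real \<Rightarrow> real \<Rightarrow> real \<Rightarrow> real" where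
  "fire_rate \<alpha> \<beta> \<gamma> a b =
     (if a = 0 \<and> b = 0 then 0
      else if a = 1 \<and> b = 0 then \<alpha>
      else if a = 0 \<and> b = 1 then \<beta>
      else \<gamma>)"

definition fire_count :: "(nat \<Rightarrow> nat \<Rightarrow> 'a \<Rightarrow> real) \<Rightarrow> nat \<Rightarrow> 'a \<Rightarrow> real" where
  "fire_count X n \<omega> = (\<Sum>j=0..n. diag_site X n (int j) \<omega>)"

locale forest_fire_field = prob_space M
  for M :: "'a measure" and \<alpha> \<beta> \<gamma> :: real and X :: "nat \<Rightarrow> nat \<Rightarrow> 'a \<Rightarrow> real" +
  assumes params: "0 \<le> \<alpha>" "0 \<le> \<beta>" "\<alpha> \<le> \<gamma>" "\<beta> \<le> \<gamma>" "\<gamma> \<le> 1"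
    and random_variable: "\<And>j k. X j k \<in> borel_measurable M"
    and zero_one_valued: "\<And>j k \<omega>. \<omega> \<in> space M \<Longrightarrow> X j k \<omega> \<in> {0, 1}"
    and origin: "\<And>\<omega>. \<omega> \<in> space M \<Longrightarrow> X 0 0 \<omega> = 1"
    and cond_indep:
      "\<And>n. cond_indep_vars M (past_alg M X n) (\<lambda>_. borel)
             (\<lambda>j. diag_site X (Suc n) (int j)) {0..Suc n}"
    and cond_law:
      "\<And>n j. j \<le> Suc n \<Longrightarrow>
         AE \<omega> in M.
           cond_prob_alg M (past_alg M X n)
             {\<omega> \<in> space M. diag_site X (Suc n) (int j) \<omega> = 1} \<omega>
           = fire_rate \<alpha> \<beta> \<gamma> (diag_site X n (int j - 1) \<omega>) (diag_site X n (int j) \<omega>)"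
begin

lemma subalgebra_past_alg: "subalgebra M (past_alg M X n)"
proof -
  have "diag_site X m (int j) \<in> borel_measurable M" for m j
    using random_variable unfolding diag_site_def[abs_def] by simp
  then have *: "{diag_site X m (int j) -` A \<inter> space M | j m A. j \<le> m \<and> m \<le> n \<and> A \<in> sets borel}
      \<subseteq> sets M"
    by (auto intro: measurable_sets)
  then have "{diag_site X m (int j) -` A \<inter> space M | j m A. j \<le> m \<and> m \<le> n \<and> A \<in> sets borel}
      \<subseteq> Pow (space M)"
    using sets.space_closed by blast
  with * show ?thesis
    by (simp add: subalgebra_def past_alg_def sets.sigma_sets_subset)
qed

end

end

theory Submission
  imports Defs
begin

text \<open>Let \<open>S\<close> be the set of occupied sites of a diagonal, \<open>w\<close> the distance between its extreme
  sites plus one (\<open>0\<close> if \<open>S\<close> is empty) and \<open>r = (1 - \<alpha>)(1 - \<beta>) / (\<alpha>\<beta>)\<close>. The left end of \<open>S\<close>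
  survives with probability \<open>\<beta>\<close>, the right end advances with probability \<open>\<alpha>\<close>, independently, and
  nothing is born beyond. If sites with two occupied parents never failed, \<open>w\<close> would be a random walk
  with up-probability \<open>\<alpha>\<beta>\<close> and down-probability \<open>(1 - \<alpha>)(1 - \<beta>)\<close>, and \<open>r\<^sup>w\<close> a martingale; in general
  \<open>r\<^sup>w\<close> is a submartingale, so its mean stays at least \<open>r\<close>. As \<open>\<gamma> < 1\<close>, each diagonal with
  \<open>0 < w \<le> K\<close> is followed by extinction with probability at least \<open>(1 - \<gamma>)\<^sup>K\<^sup>+\<^sup>1\<close>; hence
  \<open>P(0 < w \<le> K)\<close> vanishes in the limit and \<open>r\<close> is at most the extinction probability plus
  \<open>r\<^sup>K\<^sup>+\<^sup>1\<close>, for every \<open>K\<close>. The bound on the mean follows since \<open>Y\<^sub>n \<le> n + 1\<close>.\<close>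

section \<open>Width of a set of sites\<close>

definition width :: "nat set \<Rightarrow> nat" where
  "width S = (if S = {} then 0 else Suc (Max S - Min S))"

lemma width_empty [simp]: "width {} = 0"
  by (simp add: width_def)

lemma width_eq_0_iff [simp]: "width S = 0 \<longleftrightarrow> S = {}"
  by (simp add: width_def)

text \<open>There are \<open>b - a - 1\<close> sites strictly between \<open>a\<close> and
  \<open>b\<close>, and each end adds one only when it is occupied. This turns the fate of the two
  extreme sites into a bound on the next width, whatever happens between them.\<close>

lemma width_le:
  assumes "S \<subseteq> {a..b}" "a < b"
  shows "width S \<le> b - a - 1 + of_bool (a \<in> S) + of_bool (b \<in> S)"
proof (cases "S = {}")
  case False
  have fin: "finite S" using assms(1) finite_subset by blast
  have mem: "Min S \<in> S" "Max S \<in> S" using fin False by auto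
  have le: "Min S \<le> Max S" using fin False by simp
  have "Min S \<ge> a + of_bool (a \<notin> S)"
    using mem(1) assms(1) by (cases "Min S = a") force+
  moreover have "Max S + of_bool (b \<notin> S) \<le> b"
    using mem(2) assms(1) by (cases "Max S = b") force+
  ultimately show ?thesis
    using False le assms(2) by (auto simp: width_def of_bool_def split: if_splits)
qed (simp add: assms)

section \<open>The occupied set of a diagonal\<close>

definition ones :: "(nat \<Rightarrow> nat \<Rightarrow> 'a \<Rightarrow> real) \<Rightarrow> nat \<Rightarrow> 'a \<Rightarrow> nat set" where
  "ones X n \<omega> = {j. j \<le> n \<and> diag_site X n (int j) \<omega> = 1}"

lemma ones_subset: "ones X n \<omega> \<subseteq> {..n}"
  by (auto simp: ones_def)

lemma finite_ones [simp]: "finite (ones X n \<omega>)"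
  by (rule finite_subset[OF ones_subset]) simp

context forest_fire_field
begin

text \<open>The left parent of \<open>j\<close> is \<open>j - 1\<close>. Testing \<open>j\<close>
  against the successors of \<open>S\<close> stays within the naturals and fails at
  \<open>j = 0\<close>, as the boundary value 0 demands.\<close>

definition rate :: "nat set \<Rightarrow> nat \<Rightarrow> real" where
  "rate S j = fire_rate \<alpha> \<beta> \<gamma> (of_bool (j \<in> Suc ` S)) (of_bool (j \<in> S))"

lemma rate_le: "rate S j \<le> \<gamma>"
proof -
  have "0 \<le> \<gamma>" using params by linarith
  then show ?thesis using params(3,4) unfolding rate_def fire_rate_def by simp
qed

lemma rate_eq_0: "j \<notin> S \<Longrightarrow> j \<notin> Suc ` S \<Longrightarrow> rate S j = 0"
  unfolding rate_def fire_rate_def by simp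

lemma diag_site_measurable [measurable]: "diag_site X n j \<in> borel_measurable M"
  using random_variable unfolding diag_site_def[abs_def] by simp

lemma diag_site_eq_of_bool:
  assumes "\<omega> \<in> space M"
  shows "diag_site X n (int j) \<omega> = of_bool (j \<in> ones X n \<omega>)"
  using zero_one_valued[OF assms, of j "n - j"] by (auto simp: ones_def diag_site_def)

lemma diag_site_pred_eq_of_bool:
  assumes "\<omega> \<in> space M"
  shows "diag_site X n (int j - 1) \<omega> = of_bool (j \<in> Suc ` ones X n \<omega>)"
proof (cases j)
  case (Suc i)
  then show ?thesis using diag_site_eq_of_bool[OF assms, of n i] by (simp add: image_iff)
qed (simp add: diag_site_def image_iff)

lemma fire_count_eq_card:
  assumes "\<omega> \<in> space M"
  shows "fire_count X n \<omega> = real (card (ones X n \<omega>))"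
proof -
  have "{0..n} \<inter> {j. j \<in> ones X n \<omega>} = ones X n \<omega>"
    using ones_subset[of X n \<omega>] by fastforce
  then show ?thesis
    unfolding fire_count_def by (simp only: diag_site_eq_of_bool[OF assms] of_bool_def
        sum.inter_restrict[symmetric] sum.If_cases finite_atLeastAtMost) simp
qed

lemma ones_0: "\<omega> \<in> space M \<Longrightarrow> ones X 0 \<omega> = {0}"
  using origin[of \<omega>] by (auto simp: ones_def diag_site_def)

section \<open>Configurations as events\<close>

definition config :: "nat \<Rightarrow> nat set \<Rightarrow> 'a set" where
  "config n S = {\<omega> \<in> space M. ones X n \<omega> = S}"

text \<open>Exhibits the event as a finite intersection of generators of the past. Vacancy is
  written as \<open>- {1}\<close> because \<open>ones\<close> only tests for the value 1, so the
  equality holds without appeal to the values being 0 or 1.\<close>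

lemma config_eq_Inter:
  assumes "S \<subseteq> {..n}"
  shows "config n S = (\<Inter>j\<in>{..n}. diag_site X n (int j) -` (if j \<in> S then {1} else - {1}) \<inter> space M)"
proof -
  have "ones X n \<omega> = S \<longleftrightarrow> (\<forall>j\<in>{..n}. diag_site X n (int j) \<omega> \<in> (if j \<in> S then {1} else - {1}))" for \<omega>
    using assms unfolding ones_def set_eq_iff by (auto split: if_splits)
  then show ?thesis unfolding config_def by blast
qed

lemma config_in_past:
  assumes "S \<subseteq> {..n}"
  shows "config n S \<in> sets (past_alg M X n)"
proof -
  have "diag_site X n (int j) -` A \<inter> space M \<in> sets (past_alg M X n)"
    if "j \<le> n" "A \<in> sets borel" for j A
  proof -
    have "{diag_site X m (int j) -` A \<inter> space M | j m A. j \<le> m \<and> m \<le> n \<and> A \<in> sets borel}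
        \<subseteq> Pow (space M)" by auto
    then show ?thesis
      unfolding past_alg_def using that by (auto intro!: sigma_sets.Basic)
  qed
  then show ?thesis
    unfolding config_eq_Inter[OF assms] by (intro sets.finite_INT) auto
qed

lemma config_sets [measurable]: "config n S \<in> sets M"
proof (cases "S \<subseteq> {..n}")
  case True
  then show ?thesis
    using config_in_past subalgebra_past_alg[of n] by (auto simp: subalgebra_def)
next
  case False
  then have "config n S = {}" using ones_subset[of X n] unfolding config_def Collect_empty_eq by fast
  then show ?thesis by simp
qed

text \<open>Each diagonal has finitely many possible occupied sets, so any predicate
  \<open>P\<close> of two diagonals yields a finite union of configuration events.\<close>

lemma ones_pair_sets:
  "{\<omega> \<in> space M. P (ones X n \<omega>) (ones X m \<omega>)} \<in> sets M"
proof -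
  have "{\<omega> \<in> space M. P (ones X n \<omega>) (ones X m \<omega>)}
      = (\<Union>S\<in>Pow {..n}. \<Union>T\<in>{T \<in> Pow {..m}. P S T}. config n S \<inter> config m T)"
    by (auto simp: config_def subsetD[OF ones_subset, simplified])
  moreover have "(\<Union>S\<in>Pow {..n}. \<Union>T\<in>{T \<in> Pow {..m}. P S T}. config n S \<inter> config m T) \<in> sets M"
    by (intro sets.finite_UN sets.Int config_sets) auto
  ultimately show ?thesis by simp
qed

lemma ones_measurable [measurable]: "ones X n \<in> measurable M (count_space UNIV)"
proof (rule measurableI)
  fix A
  have "ones X n -` A \<inter> space M = {\<omega> \<in> space M. ones X n \<omega> \<in> A}" by auto
  then show "ones X n -` A \<inter> space M \<in> sets M"
    using ones_pair_sets[where n = n and m = n and P = "\<lambda>S _. S \<in> A"] by simp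
qed simp

section \<open>One-step transition probabilities\<close>

lemma cond_prob_site:
  assumes "j \<le> Suc n"
  shows "AE \<omega> in M. cond_prob_alg M (past_alg M X n)
      (diag_site X (Suc n) (int j) -` (if j \<in> T then {1} else - {1}) \<inter> space M) \<omega>
    = (if j \<in> T then rate (ones X n \<omega>) j else 1 - rate (ones X n \<omega>) j)"
proof -
  interpret F: finite_measure_subalgebra M "past_alg M X n"
    by unfold_locales (rule subalgebra_past_alg)
  let ?E = "{\<omega> \<in> space M. diag_site X (Suc n) (int j) \<omega> = 1}"
  have E: "?E \<in> sets M" by measurable
  have one: "AE \<omega> in M. cond_prob_alg M (past_alg M X n) ?E \<omega> = rate (ones X n \<omega>) j"
    using cond_law[OF assms] AE_space
    by eventually_elim (simp add: rate_def diag_site_eq_of_bool diag_site_pred_eq_of_bool)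
  show ?thesis
  proof (cases "j \<in> T")
    case True
    have "diag_site X (Suc n) (int j) -` {1} \<inter> space M = ?E" by auto
    then show ?thesis using one True by simp
  next
    case False
    \<comment> \<open>Vacancy is the complement of \<open>?E\<close>, so linearity of conditional
      expectation gives one minus the rate.\<close>
    have eq: "diag_site X (Suc n) (int j) -` (- {1}) \<inter> space M = space M - ?E" by auto
    have "AE \<omega> in M. real_cond_exp M (past_alg M X n) (\<lambda>\<omega>. 1 - indicator ?E \<omega>) \<omega>
        = real_cond_exp M (past_alg M X n) (\<lambda>_. 1) \<omega> - real_cond_exp M (past_alg M X n) (indicator ?E) \<omega>"
      using E by (intro F.real_cond_exp_diff integrable_const integrable_real_indicator) (auto simp: emeasure_eq_measure)
    moreover have "AE \<omega> in M. real_cond_exp M (past_alg M X n) (\<lambda>_. 1::real) \<omega> = 1"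
      by (intro F.real_cond_exp_F_meas) auto
    moreover have "AE \<omega> in M. real_cond_exp M (past_alg M X n) (indicator (space M - ?E)) \<omega>
        = real_cond_exp M (past_alg M X n) (\<lambda>\<omega>. 1 - indicator ?E \<omega>) \<omega>"
      using E by (intro F.real_cond_exp_cong AE_I2) (auto simp: indicator_def)
    ultimately show ?thesis
      using one unfolding if_not_P[OF False] eq cond_prob_alg_def by eventually_elim simp
  qed
qed

text \<open>By conditional independence the conditional probability is a product of rates, which is
  constant on \<open>config n S\<close>; that event lies in the past, so integrating over it gives
  the formula. The set \<open>J\<close> is left free: below it is a single site, the two extreme
  sites, or the whole diagonal.\<close>

lemma prob_transition:
  assumes S: "S \<subseteq> {..n}" and J: "J \<subseteq> {..Suc n}" "J \<noteq> {}"
  shows "prob {\<omega> \<in> space M. ones X n \<omega> = S \<and> (\<forall>j\<in>J. j \<in> ones X (Suc n) \<omega> \<longleftrightarrow> j \<in> T)}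
    = prob (config n S) * (\<Prod>j\<in>J. if j \<in> T then rate S j else 1 - rate S j)"
proof -
  interpret F: finite_measure_subalgebra M "past_alg M X n"
    by unfold_locales (rule subalgebra_past_alg)
  define A where "A j = (if j \<in> T then {1} else - {1::real})" for j
  define V where "V j = diag_site X (Suc n) (int j) -` A j \<inter> space M" for j
  let ?E = "\<Inter>j\<in>J. V j"
  have finJ: "finite J" using J finite_subset by blast
  have A: "A j \<in> sets borel" for j by (simp add: A_def)
  have E: "?E \<in> sets M"
    unfolding V_def using J finJ A by (intro sets.finite_INT measurable_sets[OF diag_site_measurable]) auto
  have "AE \<omega> in M. cond_prob_alg M (past_alg M X n) ?E \<omega>
      = (\<Prod>j\<in>J. cond_prob_alg M (past_alg M X n) (V j) \<omega>)"
    using cond_indep[of n] J finJ A unfolding cond_indep_vars_def V_def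
    by (auto simp: atLeast0AtMost)
  moreover have "AE \<omega> in M. \<forall>j\<in>J. cond_prob_alg M (past_alg M X n) (V j) \<omega>
      = (if j \<in> T then rate (ones X n \<omega>) j else 1 - rate (ones X n \<omega>) j)"
    unfolding V_def A_def using finJ J by (intro AE_finite_allI cond_prob_site) auto
  ultimately have cp: "AE \<omega> in M. real_cond_exp M (past_alg M X n) (indicator ?E) \<omega>
      = (\<Prod>j\<in>J. if j \<in> T then rate (ones X n \<omega>) j else 1 - rate (ones X n \<omega>) j)"
    unfolding cond_prob_alg_def by eventually_elim simp
  have "{\<omega> \<in> space M. ones X n \<omega> = S \<and> (\<forall>j\<in>J. j \<in> ones X (Suc n) \<omega> \<longleftrightarrow> j \<in> T)} = config n S \<inter> ?E"
  proof -
    have "(j \<in> ones X (Suc n) \<omega> \<longleftrightarrow> j \<in> T) \<longleftrightarrow> diag_site X (Suc n) (int j) \<omega> \<in> A j" if "j \<in> J" for j \<omega>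
      using that J by (auto simp: A_def ones_def)
    then show ?thesis using J(2) by (auto simp: config_def V_def)
  qed
  then have "prob {\<omega> \<in> space M. ones X n \<omega> = S \<and> (\<forall>j\<in>J. j \<in> ones X (Suc n) \<omega> \<longleftrightarrow> j \<in> T)}
      = (\<integral>\<omega>\<in>config n S. indicator ?E \<omega> \<partial>M)"
    using E by (simp add: set_lebesgue_integral_def flip: indicator_inter_arith)
  \<comment> \<open>Defining property of conditional expectation, applied on an event of the
    past.\<close>
  also have "\<dots> = (\<integral>\<omega>\<in>config n S. real_cond_exp M (past_alg M X n) (indicator ?E) \<omega> \<partial>M)"
    using E by (intro F.real_cond_exp_intA config_in_past S integrable_real_indicator) (auto simp: emeasure_eq_measure)
  also have "\<dots> = (\<integral>\<omega>. indicator (config n S) \<omega>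
      * (\<Prod>j\<in>J. if j \<in> T then rate S j else 1 - rate S j) \<partial>M)"
    unfolding set_lebesgue_integral_def
  proof (intro integral_cong_AE)
    show "AE \<omega> in M. indicator (config n S) \<omega> *\<^sub>R real_cond_exp M (past_alg M X n) (indicator ?E) \<omega>
        = indicator (config n S) \<omega> * (\<Prod>j\<in>J. if j \<in> T then rate S j else 1 - rate S j)"
      using cp by eventually_elim (auto simp: indicator_def config_def cong: prod.cong)
  qed auto
  also have "\<dots> = prob (config n S) * (\<Prod>j\<in>J. if j \<in> T then rate S j else 1 - rate S j)"
    by simp
  finally show ?thesis .
qed

text \<open>A site with two vacant parents has rate 0, and only finitely many null events, one for
  each pair of \<open>S\<close> and \<open>j\<close>, have to be discarded. With
  \<open>S = {}\<close> this says that extinction is absorbing.\<close>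

lemma AE_ones_Suc_subset: "AE \<omega> in M. ones X (Suc n) \<omega> \<subseteq> ones X n \<omega> \<union> Suc ` ones X n \<omega>"
proof -
  have "AE \<omega> in M. \<forall>S\<in>Pow {..n}. \<forall>j\<in>{..Suc n} - (S \<union> Suc ` S).
      \<not> (ones X n \<omega> = S \<and> j \<in> ones X (Suc n) \<omega>)"
  proof (intro AE_finite_allI)
    fix S j assume S: "S \<in> Pow {..n}" and j: "j \<in> {..Suc n} - (S \<union> Suc ` S)"
    have "prob {\<omega> \<in> space M. ones X n \<omega> = S \<and> (\<forall>i\<in>{j}. i \<in> ones X (Suc n) \<omega> \<longleftrightarrow> i \<in> {j})} = 0"
      using S j by (subst prob_transition) (auto simp: rate_eq_0)
    then show "AE \<omega> in M. \<not> (ones X n \<omega> = S \<and> j \<in> ones X (Suc n) \<omega>)"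
      by (subst (asm) prob_eq_0)
          (use ones_pair_sets[where n = n and m = "Suc n" and P = "\<lambda>A B. A = S \<and> j \<in> B"] in auto)
  qed auto
  then show ?thesis
  proof eventually_elim
    case (elim \<omega>)
    then show ?case using ones_subset[of X n \<omega>] ones_subset[of X "Suc n" \<omega>] by blast
  qed
qed

lemma sum_config:
  fixes f :: "nat set \<Rightarrow> real"
  assumes "\<omega> \<in> space M"
  shows "(\<Sum>S\<in>Pow {..n}. indicator (config n S) \<omega> * f S) = f (ones X n \<omega>)"
proof -
  have "(\<Sum>S\<in>Pow {..n}. indicator (config n S) \<omega> * f S)
      = (\<Sum>S\<in>Pow {..n}. if ones X n \<omega> = S then f S else 0)"
    using assms by (intro sum.cong) (auto simp: config_def indicator_def)
  also have "\<dots> = f (ones X n \<omega>)"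
    using ones_subset[of X n \<omega>] by (simp add: sum.delta)
  finally show ?thesis .
qed

section \<open>Powers of the width form a submartingale in mean\<close>

lemma integrable_power_width:
  assumes "0 \<le> r" "r \<le> (1::real)"
  shows "integrable M (\<lambda>\<omega>. r ^ width (ones X n \<omega>))"
proof (rule integrable_const_bound[where B = 1])
  show "AE \<omega> in M. norm (r ^ width (ones X n \<omega>)) \<le> 1"
    using assms by (simp add: power_le_one)
qed (rule measurable_compose[OF ones_measurable], simp)

text \<open>Pretend that all sites strictly between the two ends become occupied whenever an end is
  vacant: this can only enlarge the width, hence lower the power since \<open>r \<le> 1\<close>.
  What remains is the product of the generating functions of two independent Bernoulli variables,
  which \<open>fix_r\<close> evaluates to \<open>r\<close>.\<close>

lemma power_width_step:
  assumes S: "S \<subseteq> {..n}" and r: "0 < r" "r \<le> 1"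
    and fix_r: "(1 - \<beta> + \<beta> * r) * (1 - \<alpha> + \<alpha> * r) = r"
  shows "r ^ width S * prob (config n S)
    \<le> (\<integral>\<omega>. indicator (config n S) \<omega> * r ^ width (ones X (Suc n) \<omega>) \<partial>M)"
proof (cases "S = {}")
  case True
  \<comment> \<open>Extinction persists, so the power keeps the value 1.\<close>
  have "(\<integral>\<omega>. indicator (config n S) \<omega> * r ^ width (ones X (Suc n) \<omega>) \<partial>M)
      = (\<integral>\<omega>. indicator (config n S) \<omega> \<partial>M)"
  proof (intro integral_cong_AE)
    show "AE \<omega> in M. indicator (config n S) \<omega> * r ^ width (ones X (Suc n) \<omega>)
        = indicator (config n S) \<omega>"
      using AE_ones_Suc_subset[of n]
      by eventually_elim (auto simp: indicator_def config_def True)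
  qed (use integrable_power_width[of r "Suc n"] r in auto)
  then show ?thesis using True by simp
next
  case False
  have finS: "finite S" using S finite_subset by blast
  \<comment> \<open>\<open>R\<close> is one beyond the last occupied site. Thus \<open>L\<close> has
    only its parent \<open>L\<close> occupied, giving \<beta>, and \<open>R\<close> only its parent
    \<open>R - 1\<close>, giving \<alpha>.\<close>
  define L R where "L = Min S" and "R = Suc (Max S)"
  have L: "L \<in> S" and RS: "R \<in> Suc ` S" using finS False by (auto simp: L_def R_def)
  have bounds: "L \<le> j" "j < R" if "j \<in> S" for j
    using that finS by (auto simp: L_def R_def less_Suc_eq_le)
  have "L < R" using bounds(2)[OF L] .
  have w: "width S = R - L"
    using False \<open>L < R\<close> by (simp add: width_def L_def R_def Suc_diff_le)
  have "L \<notin> Suc ` S" using bounds(1) by fastforce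
  then have rate_L: "rate S L = \<beta>" using L by (simp add: rate_def fire_rate_def)
  have "R \<notin> S" using bounds(2) by blast
  then have rate_R: "rate S R = \<alpha>" using RS by (simp add: rate_def fire_rate_def)
  have J: "{L, R} \<subseteq> {..Suc n}" using S L RS by auto
  \<comment> \<open>For \<open>T\<close> ranging over the four subsets of \<open>{L, R}\<close>
    these events partition \<open>config n S\<close> by the fate of the two ends.\<close>
  define E where "E T = {\<omega> \<in> space M. ones X n \<omega> = S
      \<and> (\<forall>j\<in>{L, R}. j \<in> ones X (Suc n) \<omega> \<longleftrightarrow> j \<in> T)}" for T
  have E_sets [measurable]: "E T \<in> sets M" for T
    unfolding E_def by (rule ones_pair_sets)
  have prob_E: "prob (E T) = prob (config n S)
      * ((if L \<in> T then \<beta> else 1 - \<beta>) * (if R \<in> T then \<alpha> else 1 - \<alpha>))" for T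
    unfolding E_def using prob_transition[OF S J, of T] \<open>L < R\<close> by (simp add: rate_L rate_R)
  \<comment> \<open>On \<open>config n S\<close> this is \<open>r\<close> to the power
    \<open>R - L - 1\<close> plus the number of occupied ends, the lower bound supplied by
    \<open>width_le\<close>; elsewhere it is 0.\<close>
  define u where "u \<omega> = r ^ (R - L - 1) * (indicator (E {}) \<omega> + r * indicator (E {L}) \<omega>
      + r * indicator (E {R}) \<omega> + r\<^sup>2 * indicator (E {L, R}) \<omega>)" for \<omega>
  have int_ind: "integrable M (indicator (E T) :: 'a \<Rightarrow> real)" for T
    by (intro integrable_real_indicator) (auto simp: emeasure_eq_measure)
  have int_u: "integrable M u"
    unfolding u_def by (intro integrable_mult_right Bochner_Integration.integrable_add int_ind)
  have "integral\<^sup>L M u = r ^ (R - L - 1)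
      * (prob (E {}) + r * prob (E {L}) + r * prob (E {R}) + r\<^sup>2 * prob (E {L, R}))"
    unfolding u_def by (simp add: int_ind)
  also have "\<dots> = r ^ (R - L - 1) * (prob (config n S) * ((1 - \<beta> + \<beta> * r) * (1 - \<alpha> + \<alpha> * r)))"
    using \<open>L < R\<close> by (simp add: prob_E) (simp add: algebra_simps power2_eq_square)
  also have "\<dots> = r ^ Suc (R - L - 1) * prob (config n S)"
    by (simp add: fix_r)
  \<comment> \<open>The factor \<open>r\<close> from \<open>fix_r\<close> restores the one site by
    which the interior \<open>R - L - 1\<close> falls short of the old width
    \<open>R - L\<close>.\<close>
  also have "Suc (R - L - 1) = width S" using w \<open>L < R\<close> by simp
  finally have "r ^ width S * prob (config n S) = integral\<^sup>L M u" ..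
  also have "\<dots> \<le> (\<integral>\<omega>. indicator (config n S) \<omega> * r ^ width (ones X (Suc n) \<omega>) \<partial>M)"
  proof (rule integral_mono_AE[OF int_u])
    have "integrable M (\<lambda>\<omega>. indicator (config n S) \<omega> *\<^sub>R r ^ width (ones X (Suc n) \<omega>))"
      using r by (intro integrable_mult_indicator integrable_power_width config_sets) auto
    then show "integrable M (\<lambda>\<omega>. indicator (config n S) \<omega> * r ^ width (ones X (Suc n) \<omega>))"
      by simp
    show "AE \<omega> in M. u \<omega> \<le> indicator (config n S) \<omega> * r ^ width (ones X (Suc n) \<omega>)"
      using AE_ones_Suc_subset[of n] AE_space
    proof eventually_elim
      case (elim \<omega>)
      show ?case
      proof (cases "ones X n \<omega> = S")
        case True
        let ?S' = "ones X (Suc n) \<omega>"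
        have "?S' \<subseteq> {L..R}" using elim(1) bounds True by fastforce
        then have "width ?S' \<le> R - L - 1 + of_bool (L \<in> ?S') + of_bool (R \<in> ?S')"
          using \<open>L < R\<close> by (rule width_le)
        then have "r ^ (R - L - 1 + of_bool (L \<in> ?S') + of_bool (R \<in> ?S')) \<le> r ^ width ?S'"
          using r by (intro power_decreasing) auto
        moreover have "u \<omega> = r ^ (R - L - 1 + of_bool (L \<in> ?S') + of_bool (R \<in> ?S'))"
          using True elim(2) \<open>L < R\<close>
          by (cases "L \<in> ?S'"; cases "R \<in> ?S'")
            (simp_all add: u_def E_def power_add power2_eq_square)
        ultimately show ?thesis using True elim(2) by (simp add: config_def)
      qed (simp add: u_def E_def config_def)
    qed
  qed
  finally show ?thesis .
qed

text \<open>Sums the one-step inequality over the configurations of diagonal \<open>n\<close>, which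
  partition the space.\<close>

lemma power_width_submartingale:
  assumes r: "0 < r" "r \<le> 1"
    and fix_r: "(1 - \<beta> + \<beta> * r) * (1 - \<alpha> + \<alpha> * r) = r"
  shows "(\<integral>\<omega>. r ^ width (ones X n \<omega>) \<partial>M) \<le> (\<integral>\<omega>. r ^ width (ones X (Suc n) \<omega>) \<partial>M)"
proof -
  have int: "integrable M (\<lambda>\<omega>. indicator (config n S) \<omega> * r ^ width (ones X (Suc n) \<omega>))" for S
    using integrable_mult_indicator[OF config_sets integrable_power_width[of r "Suc n"], of n S] r
    by simp
  have int': "integrable M (\<lambda>\<omega>. indicator (config n S) \<omega> * c)" for S and c :: real
    by (intro integrable_mult_left integrable_real_indicator) (auto simp: emeasure_eq_measure)
  have "(\<integral>\<omega>. r ^ width (ones X n \<omega>) \<partial>M)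
      = (\<integral>\<omega>. (\<Sum>S\<in>Pow {..n}. indicator (config n S) \<omega> * r ^ width S) \<partial>M)"
    by (intro Bochner_Integration.integral_cong refl sum_config[symmetric])
  also have "\<dots> = (\<Sum>S\<in>Pow {..n}. r ^ width S * prob (config n S))"
    by (subst Bochner_Integration.integral_sum[OF int']) (simp add: mult.commute)
  also have "\<dots> \<le> (\<Sum>S\<in>Pow {..n}. \<integral>\<omega>. indicator (config n S) \<omega> * r ^ width (ones X (Suc n) \<omega>) \<partial>M)"
    using assms by (intro sum_mono power_width_step) auto
  also have "\<dots> = (\<integral>\<omega>. (\<Sum>S\<in>Pow {..n}. indicator (config n S) \<omega> * r ^ width (ones X (Suc n) \<omega>)) \<partial>M)"
    by (subst Bochner_Integration.integral_sum) (auto simp: int)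
  also have "\<dots> = (\<integral>\<omega>. r ^ width (ones X (Suc n) \<omega>) \<partial>M)"
    by (intro Bochner_Integration.integral_cong refl sum_config)
  finally show ?thesis .
qed

section \<open>Extinction from a narrow configuration\<close>

lemma prob_immediate_extinction_ge:
  assumes S: "S \<subseteq> {..n}" "S \<noteq> {}"
  shows "prob (config n S) * (1 - \<gamma>) ^ Suc (width S)
    \<le> prob {\<omega> \<in> space M. ones X n \<omega> = S \<and> ones X (Suc n) \<omega> = {}}"
proof -
  let ?B = "S \<union> Suc ` S"
  have finS: "finite S" using S finite_subset by blast
  \<comment> \<open>Only sites of \<open>?B\<close> can be occupied next, and they lie in an
    interval one site longer than the width of \<open>S\<close>.\<close>
  have "?B \<subseteq> {Min S..Suc (Max S)}" using finS by (auto simp: le_SucI Min_le_iff intro: le_SucI)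
  then have "card ?B \<le> card {Min S..Suc (Max S)}" by (intro card_mono) auto
  also have "Min S \<le> Max S" using finS S by simp
  then have "card {Min S..Suc (Max S)} = Suc (width S)"
    using S by (simp add: width_def Suc_diff_le)
  finally have card: "card ?B \<le> Suc (width S)" .
  have "(1 - \<gamma>) ^ Suc (width S) \<le> (1 - \<gamma>) ^ card ?B"
    using card params by (intro power_decreasing) auto
  also have "\<dots> = (\<Prod>j\<in>?B. 1 - \<gamma>)" by simp
  also have "\<dots> \<le> (\<Prod>j\<in>?B. 1 - rate S j)"
    using params rate_le by (intro prod_mono) auto
  \<comment> \<open>Sites outside \<open>?B\<close> have rate 0 and contribute factors 1.\<close>
  also have "\<dots> = (\<Prod>j\<le>Suc n. 1 - rate S j)"
    using S by (intro prod.mono_neutral_left) (auto simp: rate_eq_0)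
  finally have "prob (config n S) * (1 - \<gamma>) ^ Suc (width S)
      \<le> prob (config n S) * (\<Prod>j\<le>Suc n. 1 - rate S j)"
    by (intro mult_left_mono) auto
  also have "\<dots> = prob {\<omega> \<in> space M. ones X n \<omega> = S \<and> (\<forall>j\<in>{..Suc n}. j \<in> ones X (Suc n) \<omega> \<longleftrightarrow> j \<in> {})}"
    using prob_transition[of S n "{..Suc n}" "{}"] S by simp
  also have "{\<omega> \<in> space M. ones X n \<omega> = S \<and> (\<forall>j\<in>{..Suc n}. j \<in> ones X (Suc n) \<omega> \<longleftrightarrow> j \<in> {})}
      = {\<omega> \<in> space M. ones X n \<omega> = S \<and> ones X (Suc n) \<omega> = {}}"
    by (auto simp: ones_def)
  finally show ?thesis .
qed

lemma extinct_step:
  "prob {\<omega> \<in> space M. ones X n \<omega> = {}}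
    = prob {\<omega> \<in> space M. ones X n \<omega> = {} \<and> ones X (Suc n) \<omega> = {}}"
proof (rule finite_measure_eq_AE)
  show "AE \<omega> in M. (\<omega> \<in> {\<omega> \<in> space M. ones X n \<omega> = {}})
      = (\<omega> \<in> {\<omega> \<in> space M. ones X n \<omega> = {} \<and> ones X (Suc n) \<omega> = {}})"
    using AE_ones_Suc_subset[of n] by eventually_elim auto
qed (rule ones_pair_sets)+

lemma extinct_mono:
  "prob {\<omega> \<in> space M. ones X n \<omega> = {}} \<le> prob {\<omega> \<in> space M. ones X (Suc n) \<omega> = {}}"
  unfolding extinct_step[of n] by (intro finite_measure_mono) auto

text \<open>Each narrow nonempty configuration dies at once with conditional probability at least
  \<open>(1 - \<gamma>) ^ Suc K\<close>, and such deaths are new extinctions. The right-hand side is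
  an increment of a bounded monotone sequence, so it will vanish in the limit.\<close>

lemma prob_narrow_le:
  "prob {\<omega> \<in> space M. 0 < width (ones X n \<omega>) \<and> width (ones X n \<omega>) \<le> K} * (1 - \<gamma>) ^ Suc K
    \<le> prob {\<omega> \<in> space M. ones X (Suc n) \<omega> = {}} - prob {\<omega> \<in> space M. ones X n \<omega> = {}}"
proof -
  define F where "F = {S \<in> Pow {..n}. 0 < width S \<and> width S \<le> K}"
  have finF: "finite F" by (simp add: F_def)
  let ?D = "\<lambda>S. {\<omega> \<in> space M. ones X n \<omega> = S \<and> ones X (Suc n) \<omega> = {}}"
  have narrow: "{\<omega> \<in> space M. 0 < width (ones X n \<omega>) \<and> width (ones X n \<omega>) \<le> K} = (\<Union>S\<in>F. config n S)"
    using ones_subset[of X n] by (auto simp: F_def config_def simp del: width_eq_0_iff)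
  have "prob (\<Union>S\<in>F. config n S) = (\<Sum>S\<in>F. prob (config n S))"
    using finF by (intro finite_measure_finite_Union) (auto simp: disjoint_family_on_def config_def[of n])
  then have "prob (\<Union>S\<in>F. config n S) * (1 - \<gamma>) ^ Suc K
      = (\<Sum>S\<in>F. prob (config n S) * (1 - \<gamma>) ^ Suc K)"
    by (simp add: sum_distrib_right)
  also have "\<dots> \<le> (\<Sum>S\<in>F. prob (?D S))"
  proof (rule sum_mono)
    fix S assume "S \<in> F"
    then have S: "S \<subseteq> {..n}" "S \<noteq> {}" "width S \<le> K" by (auto simp: F_def)
    have "prob (config n S) * (1 - \<gamma>) ^ Suc K \<le> prob (config n S) * (1 - \<gamma>) ^ Suc (width S)"
      using S params by (intro mult_left_mono power_decreasing) auto
    also have "\<dots> \<le> prob (?D S)" using S by (intro prob_immediate_extinction_ge)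
    finally show "prob (config n S) * (1 - \<gamma>) ^ Suc K \<le> prob (?D S)" .
  qed
  finally have le: "prob (\<Union>S\<in>F. config n S) * (1 - \<gamma>) ^ Suc K \<le> (\<Sum>S\<in>F. prob (?D S))" .
  \<comment> \<open>The empty configuration is added to \<open>F\<close> because
    \<open>?D {}\<close> carries the whole extinction probability at time \<open>n\<close>, by
    \<open>extinct_step\<close>.\<close>
  have "{} \<notin> F" by (simp add: F_def)
  then have "prob (?D {}) + (\<Sum>S\<in>F. prob (?D S)) = (\<Sum>S\<in>insert {} F. prob (?D S))"
    using finF by simp
  also have "\<dots> = prob (\<Union>S\<in>insert {} F. ?D S)"
    using finF ones_pair_sets
    by (intro finite_measure_finite_Union[symmetric]) (auto simp: disjoint_family_on_def)
  also have "\<dots> \<le> prob {\<omega> \<in> space M. ones X (Suc n) \<omega> = {}}"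
    by (intro finite_measure_mono) auto
  finally show ?thesis using le extinct_step[of n] narrow by simp
qed

section \<open>The limit of the extinction probabilities\<close>

lemma extinction_probability:
  assumes "\<gamma> < 1" "\<alpha> + \<beta> > 1"
  obtains q where "(\<lambda>n. prob {\<omega> \<in> space M. ones X n \<omega> = {}}) \<longlonglongrightarrow> q"
    and "(1 - \<alpha>) * (1 - \<beta>) / (\<alpha> * \<beta>) \<le> q"
proof -
  let ?a = "\<lambda>n. prob {\<omega> \<in> space M. ones X n \<omega> = {}}"
  \<comment> \<open>The equation \<open>fix_r\<close> is quadratic in \<open>r\<close> with roots 1
    and this value; \<alpha> + \<beta> > 1 makes this root less than 1.\<close>
  define r where "r = (1 - \<alpha>) * (1 - \<beta>) / (\<alpha> * \<beta>)"
  have pos: "0 < \<alpha>" "\<alpha> < 1" "0 < \<beta>" "\<beta> < 1" using assms params by linarith+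
  have r_eq: "\<alpha> * \<beta> * r = (1 - \<alpha>) * (1 - \<beta>)" using pos by (simp add: r_def)
  have r0: "0 < r" using pos by (simp add: r_def)
  have r1: "r < 1" using pos assms by (simp add: r_def algebra_simps)
  have "(1 - \<beta> + \<beta> * r) * (1 - \<alpha> + \<alpha> * r)
      = (1 - \<alpha>) * (1 - \<beta>) + (\<alpha> + \<beta> - 2 * (\<alpha> * \<beta>)) * r + (\<alpha> * \<beta> * r) * r"
    by (simp add: algebra_simps)
  also have "\<dots> = \<alpha> * \<beta> * r + (\<alpha> + \<beta> - 2 * (\<alpha> * \<beta>)) * r + (1 - \<alpha>) * (1 - \<beta>) * r"
    by (simp only: r_eq)
  also have "\<dots> = r" by (simp add: algebra_simps)
  finally have fix_r: "(1 - \<beta> + \<beta> * r) * (1 - \<alpha> + \<alpha> * r) = r" .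
  have "incseq ?a" using extinct_mono by (intro incseq_SucI)
  then obtain q where q: "?a \<longlonglongrightarrow> q"
    using incseq_convergent[of ?a 1] by auto
  \<comment> \<open>Equality holds at \<open>n = 0\<close>: the single occupied origin has width
    1.\<close>
  have mean: "r \<le> (\<integral>\<omega>. r ^ width (ones X n \<omega>) \<partial>M)" for n
  proof (induction n)
    case 0
    have "(\<integral>\<omega>. r ^ width (ones X 0 \<omega>) \<partial>M) = (\<integral>\<omega>. r \<partial>M)"
      by (intro Bochner_Integration.integral_cong) (auto simp: ones_0 width_def)
    then show ?case by (simp add: prob_space)
  next
    case (Suc n)
    then show ?case using power_width_submartingale[of r n] r0 r1 fix_r by linarith
  qed
  let ?N = "\<lambda>K n. {\<omega> \<in> space M. 0 < width (ones X n \<omega>) \<and> width (ones X n \<omega>) \<le> K}"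
  \<comment> \<open>Three cases: extinct and narrow diagonals contribute at most their
    probabilities, as the power is at most 1, and wide ones at most \<open>r ^ K\<close>.\<close>
  have bound: "r \<le> ?a n + prob (?N K n) + r ^ K" for n K
  proof -
    let ?A = "{\<omega> \<in> space M. ones X n \<omega> = {}}"
    have sets: "?A \<in> sets M" "?N K n \<in> sets M" by (rule ones_pair_sets)+
    have int: "integrable M (indicator ?A :: 'a \<Rightarrow> real)" "integrable M (indicator (?N K n) :: 'a \<Rightarrow> real)"
      using sets by (auto intro!: integrable_real_indicator simp: emeasure_eq_measure)
    have "r \<le> (\<integral>\<omega>. r ^ width (ones X n \<omega>) \<partial>M)" by (rule mean)
    also have "\<dots> \<le> (\<integral>\<omega>. indicator ?A \<omega> + indicator (?N K n) \<omega> + r ^ K \<partial>M)"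
    proof (rule integral_mono)
      fix \<omega> assume \<omega>: "\<omega> \<in> space M"
      show "r ^ width (ones X n \<omega>) \<le> indicator ?A \<omega> + indicator (?N K n) \<omega> + r ^ K"
      proof (cases "width (ones X n \<omega>) \<le> K")
        case True
        have "r ^ width (ones X n \<omega>) \<le> 1" "0 \<le> r ^ K" using r0 r1 by (simp_all add: power_le_one)
        then show ?thesis using True \<omega> by (auto simp: indicator_def)
      next
        case False
        then have "r ^ width (ones X n \<omega>) \<le> r ^ K" using r0 r1 by (intro power_decreasing) auto
        then show ?thesis by (simp add: add_increasing)
      qed
    qed (use r0 r1 int integrable_power_width in auto)
    also have "\<dots> = ?a n + prob (?N K n) + r ^ K"
      using sets int by (simp add: prob_space)
    finally show ?thesis .
  qed
  have narrow_0: "(\<lambda>n. prob (?N K n)) \<longlonglongrightarrow> 0" for K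
  proof (rule tendsto_sandwich[OF always_eventually always_eventually tendsto_const])
    let ?c = "(1 - \<gamma>) ^ Suc K"
    have c: "?c > 0" using assms by simp
    show "\<forall>n. prob (?N K n) \<le> (?a (Suc n) - ?a n) / ?c"
      using prob_narrow_le[of _ K] c by (simp only: pos_le_divide_eq) blast
    have "(\<lambda>n. (?a (Suc n) - ?a n) / ?c) \<longlonglongrightarrow> (q - q) / ?c"
      using c by (intro tendsto_intros q LIMSEQ_Suc) auto
    then show "(\<lambda>n. (?a (Suc n) - ?a n) / ?c) \<longlonglongrightarrow> 0" by simp
  qed simp
  \<comment> \<open>First \<open>n\<close> tends to infinity for fixed \<open>K\<close>, then
    \<open>K\<close> does.\<close>
  have "r \<le> q + 0 + r ^ K" for K
    using bound by (intro LIMSEQ_le_const[OF tendsto_add[OF tendsto_add[OF q narrow_0] tendsto_const]]) auto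
  moreover have "(\<lambda>K. q + 0 + r ^ K) \<longlonglongrightarrow> q + 0 + 0"
    using r0 r1 by (intro tendsto_intros LIMSEQ_realpow_zero) auto
  ultimately have "r \<le> q" using LIMSEQ_le_const by fastforce
  with q that show thesis unfolding r_def by blast
qed

section \<open>The bound on the mean\<close>

lemma mean_fire_count_le:
  "integral\<^sup>L M (fire_count X n) \<le> real (Suc n) * (1 - prob {\<omega> \<in> space M. ones X n \<omega> = {}})"
proof -
  let ?A = "{\<omega> \<in> space M. ones X n \<omega> = {}}"
  have A: "?A \<in> sets M" by (rule ones_pair_sets)
  have "integral\<^sup>L M (fire_count X n) \<le> (\<integral>\<omega>. real (Suc n) * indicator (space M - ?A) \<omega> \<partial>M)"
  proof (rule integral_mono_AE')
    show "integrable M (\<lambda>\<omega>. real (Suc n) * indicator (space M - ?A) \<omega>)"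
      using A by (intro integrable_mult_right integrable_real_indicator) (auto simp: emeasure_eq_measure)
    \<comment> \<open>The count vanishes on extinction and never exceeds the \<open>n + 1\<close>
      sites of the diagonal.\<close>
    have "fire_count X n \<omega> \<le> real (Suc n) * indicator (space M - ?A) \<omega>" if "\<omega> \<in> space M" for \<omega>
      using that card_mono[OF _ ones_subset[of X n \<omega>]] by (simp add: fire_count_eq_card indicator_def)
    then show "AE \<omega> in M. fire_count X n \<omega> \<le> real (Suc n) * indicator (space M - ?A) \<omega>" by simp
    show "AE \<omega> in M. 0 \<le> real (Suc n) * indicator (space M - ?A) \<omega>" by simp
  qed
  also have "\<dots> = real (Suc n) * prob (space M - ?A)" using A by simp
  also have "prob (space M - ?A) = 1 - prob ?A" using A by (rule prob_compl)
  finally show ?thesis .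
qed

end

theorem mainTheorem7:
  fixes M :: "'a measure" and \<alpha> \<beta> \<gamma> :: real and X :: "nat \<Rightarrow> nat \<Rightarrow> 'a \<Rightarrow> real"
  assumes "0 \<le> \<alpha>" "0 \<le> \<beta>" "\<alpha> \<le> \<gamma>" "\<beta> \<le> \<gamma>" "\<gamma> < 1"
    and "\<alpha> + \<beta> > 1"
    and "forest_fire_field M \<alpha> \<beta> \<gamma> X"
  shows "convergent (\<lambda>n. measure M {\<omega> \<in> space M. fire_count X n \<omega> = 0})
     \<and> lim (\<lambda>n. measure M {\<omega> \<in> space M. fire_count X n \<omega> = 0})
         \<ge> (1 - \<alpha>) * (1 - \<beta>) / (\<alpha> * \<beta>)
     \<and> (\<forall>\<epsilon>>0. \<exists>n0. \<forall>n\<ge>n0.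
          integral\<^sup>L M (fire_count X n) \<le> ((\<alpha> + \<beta> - 1) / (\<alpha> * \<beta>) + \<epsilon>) * real n)"
proof -
  interpret forest_fire_field M \<alpha> \<beta> \<gamma> X by fact
  define c where "c = (\<alpha> + \<beta> - 1) / (\<alpha> * \<beta>)"
  have pos: "0 < \<alpha>" "0 < \<beta>" using assms by linarith+
  have extinct_eq: "{\<omega> \<in> space M. fire_count X n \<omega> = 0} = {\<omega> \<in> space M. ones X n \<omega> = {}}" for n
    by (auto simp: fire_count_eq_card)
  let ?a = "\<lambda>n. prob {\<omega> \<in> space M. ones X n \<omega> = {}}"
  obtain q where q: "?a \<longlonglongrightarrow> q" "(1 - \<alpha>) * (1 - \<beta>) / (\<alpha> * \<beta>) \<le> q"
    by (rule extinction_probability[OF assms(5,6)])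
  \<comment> \<open>The constant of the mean bound is the complement of the extinction bound, so
    \<open>c\<close> dominates the survival probability \<open>1 - q\<close>.\<close>
  have "c = 1 - (1 - \<alpha>) * (1 - \<beta>) / (\<alpha> * \<beta>)"
    using pos by (simp add: c_def field_simps)
  then have c: "1 - q \<le> c" using q(2) by simp
  have "\<exists>n0. \<forall>n\<ge>n0. integral\<^sup>L M (fire_count X n) \<le> (c + \<epsilon>) * real n" if "\<epsilon> > 0" for \<epsilon>
  proof -
    \<comment> \<open>Half of \<epsilon> pays for replacing \<open>?a n\<close> by its limit; the
      other half, times \<open>n\<close>, pays for the extra site in \<open>n + 1\<close>, whence
      the threshold \<open>2 / \<epsilon>\<close>.\<close>
    have "\<forall>\<^sub>F n in sequentially. q - \<epsilon> / 2 < ?a n"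
      using q(1) that by (intro order_tendstoD) auto
    moreover have "\<forall>\<^sub>F n in sequentially. 2 / \<epsilon> \<le> real n"
      using filterlim_real_sequentially by (simp add: filterlim_at_top)
    ultimately have "\<forall>\<^sub>F n in sequentially. integral\<^sup>L M (fire_count X n) \<le> (c + \<epsilon>) * real n"
    proof eventually_elim
      case (elim n)
      have "integral\<^sup>L M (fire_count X n) \<le> real n * (1 - ?a n) + (1 - ?a n)"
        using mean_fire_count_le[of n] by (simp add: algebra_simps)
      also have "\<dots> \<le> real n * (c + \<epsilon> / 2) + 1"
        using elim(1) c by (intro add_mono mult_left_mono) auto
      also have "1 \<le> real n * (\<epsilon> / 2)" using elim(2) that by (simp add: field_simps)
      finally show ?case by (simp add: algebra_simps)
    qed
    then show ?thesis by (simp add: eventually_sequentially)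
  qed
  then show ?thesis
    using q by (auto simp: extinct_eq c_def convergent_def limI)
qed

end
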